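(* Let $V_1,\dots,V_m\in\mathbb{C}^{n\times n}$ satisfy $\sum_{i=1}^mV_i^*V_i=I_n$, and let $\Phi(X)=\sum_{i=1}^mV_i^*XV_i$ and $\Psi(X)=\sum_{i=1}^mV_iXV_i^*$ for $X$ in the space $\mathbf{S}_n$ of $n\times n$ Hermitian matrices. The following conditions are equivalent: 1. $\|\Phi\|_H=\|\Psi\|_H^\star=1$. 2. There are nonzero vectors $u,v\in\mathbb{C}^n$ such that $\langle V_iu,V_jv\rangle=0$ for all $i,j\in\{1,\dots,m\}$. 3. There is a rank one matrix $Y\in\mathbb{C}^{n\times n}$ such that $\operatorname{trace}(V_i^*V_jY)=0$ for all $i,j\in\{1,\dots,m\}$.
   Context: $\langle\cdot,\cdot\rangle$ is the standard Hermitian inner product on $\mathbb{C}^n$, $\langle a,b\rangle=a^*b$. $$\|\Phi\|_H=\sup_{X\in\mathbf{S}_n\setminus\mathbb{R}I_n}\frac{\lambda_{\max}(\Phi(X))-\lambda_{\min}(\Phi(X))}{\lambda_{\max}(X)-\lambda_{\min}(X)},\qquad \|\Psi\|_H^\star=\sup_{\rho_1\ne\rho_2\in\mathcal{P}(I_n)}\frac{\|\Psi(\rho_1)-\Psi(\rho_2)\|_1}{\|\rho_1-\rho_2\|_1},$$ where $\mathcal{P}(I_n)$ is the set of positive semidefinite Hermitian matrices of trace $1$ and $\|X\|_1=\sum_i|\lambda_i(X)|$ is the trace norm (both suprema are $0$ by convention if $n=1$). *)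

theory Defs
  imports "HOL-Analysis.Analysis"
begin

definition hinner :: "complex ^ 'n \<Rightarrow> complex ^ 'n \<Rightarrow> complex" where
  "hinner a b = (\<Sum>i\<in>UNIV. cnj (a $ i) * b $ i)"

definition adjoint_mat :: "complex ^ 'n ^ 'm \<Rightarrow> complex ^ 'm ^ 'n" where
  "adjoint_mat A = map_matrix cnj (transpose A)"

definition hermitian :: "complex ^ 'n ^ 'n \<Rightarrow> bool" where
  "hermitian X \<longleftrightarrow> adjoint_mat X = X"

definition charpoly :: "complex ^ 'n ^ 'n \<Rightarrow> complex poly" where
  "charpoly X = det (mat [:0, 1:] - map_matrix (\<lambda>c. [:c:]) X)"

text \<open>Eigenvalues, repeated according to their algebraic multiplicity.\<close>

definition eigvals :: "complex ^ 'n ^ 'n \<Rightarrow> complex multiset" where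
  "eigvals X = proots (charpoly X)"

text \<open>The next two functions are meant for Hermitian matrices only; all eigenvalues are then
  real, so that taking real parts loses nothing.\<close>

definition lambda_max :: "complex ^ 'n ^ 'n \<Rightarrow> real" where
  "lambda_max X = Max (Re ` set_mset (eigvals X))"

definition lambda_min :: "complex ^ 'n ^ 'n \<Rightarrow> real" where
  "lambda_min X = Min (Re ` set_mset (eigvals X))"

text \<open>The sum of the absolute values of the eigenvalues; this is the trace norm for
  Hermitian matrices (and not for arbitrary ones).\<close>

definition trace_norm :: "complex ^ 'n ^ 'n \<Rightarrow> real" where
  "trace_norm X = (\<Sum>c\<in>#eigvals X. cmod c)"

text \<open>For Hermitian \<open>X\<close> the number \<open>hinner x (X *v x)\<close> is real.\<close>

definition possemidef :: "complex ^ 'n ^ 'n \<Rightarrow> bool" where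
  "possemidef X \<longleftrightarrow> hermitian X \<and> (\<forall>x. 0 \<le> Re (hinner x (X *v x)))"

definition density_matrices :: "(complex ^ 'n ^ 'n) set" where
  "density_matrices = {\<rho>. possemidef \<rho> \<and> trace \<rho> = 1}"

text \<open>Both suprema are taken in the extended reals, where they need no boundedness condition.
  In dimension 1 they would range over an empty set, and the value is 0 by convention. The
  matrix \<open>mat c\<close> is \<open>c\<close> times the identity.\<close>

definition hilbert_opnorm :: "(complex ^ 'n ^ 'n \<Rightarrow> complex ^ 'n ^ 'n) \<Rightarrow> ereal" where
  "hilbert_opnorm \<Phi> =
     (if CARD('n) = 1 then 0
      else SUP X \<in> {X. hermitian X} - range (\<lambda>t::real. mat (complex_of_real t)).
        ereal ((lambda_max (\<Phi> X) - lambda_min (\<Phi> X)) / (lambda_max X - lambda_min X)))"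

definition hilbert_dual_opnorm :: "(complex ^ 'n ^ 'n \<Rightarrow> complex ^ 'n ^ 'n) \<Rightarrow> ereal" where
  "hilbert_dual_opnorm \<Psi> =
     (if CARD('n) = 1 then 0
      else SUP (\<rho>1, \<rho>2) \<in> {(\<rho>1, \<rho>2). \<rho>1 \<in> density_matrices \<and> \<rho>2 \<in> density_matrices \<and> \<rho>1 \<noteq> \<rho>2}.
        ereal (trace_norm (\<Psi> \<rho>1 - \<Psi> \<rho>2) / trace_norm (\<rho>1 - \<rho>2)))"

definition kraus_Phi :: "nat \<Rightarrow> (nat \<Rightarrow> complex ^ 'n ^ 'n) \<Rightarrow> complex ^ 'n ^ 'n \<Rightarrow> complex ^ 'n ^ 'n" where
  "kraus_Phi m V X = (\<Sum>i=1..m. adjoint_mat (V i) ** X ** V i)"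

definition kraus_Psi :: "nat \<Rightarrow> (nat \<Rightarrow> complex ^ 'n ^ 'n) \<Rightarrow> complex ^ 'n ^ 'n \<Rightarrow> complex ^ 'n ^ 'n" where
  "kraus_Psi m V X = (\<Sum>i=1..m. V i ** X ** adjoint_mat (V i))"

end

theory Submission
  imports Defs
begin

text \<open>
  The maps \<open>\<Phi>\<close> and \<open>\<Psi>\<close> are adjoint for the trace pairing (\<open>trace_kraus_duality\<close>), and the
  hypothesis on the \<open>V i\<close> says that \<open>\<Phi>\<close> fixes the identity, equivalently that
  \<open>\<Sum>\<^sub>i \<parallel>V i x\<parallel>\<^sup>2 = \<parallel>x\<parallel>\<^sup>2\<close>. The quadratic form of \<open>\<Phi> X\<close> at \<open>x\<close> is the sum of the values of
  the form of \<open>X\<close> at the vectors \<open>V i x\<close>, whose squared lengths add up to that of \<open>x\<close>. By the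
  extremal description of the largest and smallest eigenvalue (\<open>qform_le_lambda_max\<close>,
  \<open>lambda_max_attained\<close> and their duals) \<open>\<Phi>\<close> never increases the spread of the spectrum; by
  duality with the matrices between \<open>-1\<close> and \<open>1\<close> (\<open>trace_mult_le_trace_norm\<close>,
  \<open>trace_norm_attained\<close>) \<open>\<Psi>\<close> never increases the trace norm. So both norms are at most 1, and
  the question is when 1 is reached.

  Suppose that \<open>V i u \<bottom> V j v\<close> for all \<open>i\<close>, \<open>j\<close>, with unit vectors \<open>u\<close>, \<open>v\<close>. Let \<open>P\<close> be the
  orthogonal projection onto the span of the \<open>V i u\<close> (\<open>exists_projection\<close>). The form of
  \<open>\<Phi> P\<close> takes the value 1 at \<open>u\<close> and 0 at \<open>v\<close>, so \<open>P\<close> attains the first norm. Pairing with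
  \<open>2 P - 1\<close> shows that \<open>\<Psi> (u u\<^sup>* - v v\<^sup>* )\<close> has trace norm at least 2, which \<open>u u\<^sup>* - v v\<^sup>*\<close>
  does not exceed, so these two pure states attain the second.

  Conversely, suppose that the first norm is 1. Shifting and scaling turns any non-scalar
  Hermitian matrix into an \<^emph>\<open>effect\<close>, that is a matrix between 0 and 1, with the same ratio of
  spreads. Effects form a compact set, so the supremum is not merely approached: there are an
  effect \<open>X\<close> and unit vectors \<open>x\<close>, \<open>y\<close> at which the form of \<open>\<Phi> X\<close> has values 1 and 0. All the
  inequalities behind the upper bound are then equalities, which forces \<open>X\<close> to fix every
  \<open>V i x\<close> and to annihilate every \<open>V j y\<close> (\<open>effect_fixed\<close>, \<open>effect_kernel\<close>). Vectors in
  different eigenspaces of a Hermitian matrix are orthogonal.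

  The third condition is a restatement of the second one, since a matrix of rank one is
  \<open>v u\<^sup>*\<close> with nonzero \<open>u\<close>, \<open>v\<close> and \<open>trace (A\<^sup>* B v u\<^sup>* ) = \<langle>A u, B v\<rangle>\<close>.

  Since \<open>eigvals\<close> is defined through the roots of the characteristic polynomial, all this rests
  on the spectral theorem in the form \<open>hermitian_spectral\<close>, where the diagonal entries are
  identified with \<open>eigvals\<close>, multiplicities included.
\<close>

section \<open>Inner product, adjoints and rank-one matrices\<close>

lemma hinner_add_right: "hinner x (y + z) = hinner x y + hinner x z"
  by (simp add: hinner_def sum.distrib algebra_simps)

lemma hinner_add_left: "hinner (x + y) z = hinner x z + hinner y z"
  by (simp add: hinner_def sum.distrib algebra_simps)

lemma hinner_diff_right: "hinner x (y - z) = hinner x y - hinner x z"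
  by (simp add: hinner_def sum_subtractf algebra_simps)

lemma hinner_scale_right: "hinner x (c *s y) = c * hinner x y"
  by (simp add: hinner_def sum_distrib_left algebra_simps)

lemma hinner_scaleR_right: "hinner x (t *\<^sub>R y) = of_real t * hinner x y"
  by (simp add: hinner_def sum_distrib_left scaleR_conv_of_real[where 'a=complex] algebra_simps)

lemma hinner_scaleR_left: "hinner (t *\<^sub>R x) y = of_real t * hinner x y"
  by (simp add: hinner_def sum_distrib_left scaleR_conv_of_real[where 'a=complex] algebra_simps)

lemma hinner_zero_right [simp]: "hinner x 0 = 0"
  by (simp add: hinner_def)

lemma hinner_sum_right: "hinner x (\<Sum>k\<in>I. f k) = (\<Sum>k\<in>I. hinner x (f k))"
  by (induction I rule: infinite_finite_induct) (auto simp: hinner_add_right)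

lemma cnj_hinner: "cnj (hinner x y) = hinner y x"
  by (simp add: hinner_def algebra_simps)

lemma inner_eq_Re_hinner: "inner x y = Re (hinner x y)"
  by (simp add: hinner_def inner_vec_def inner_complex_def)

lemma hinner_self: "hinner x x = of_real ((norm x)\<^sup>2)"
proof (rule complex_eqI)
  show "Re (hinner x x) = Re (of_real ((norm x)\<^sup>2))"
    by (simp add: power2_norm_eq_inner inner_eq_Re_hinner)
  show "Im (hinner x x) = Im (of_real ((norm x)\<^sup>2))"
    using cnj_hinner[of x x] by (simp add: complex_eq_iff)
qed

lemma continuous_on_hinner [continuous_intros]:
  "continuous_on S f \<Longrightarrow> continuous_on S g \<Longrightarrow> continuous_on S (\<lambda>x. hinner (f x) (g x))"
  unfolding hinner_def by (intro continuous_intros)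

lemma continuous_on_matrix_vector_mult [continuous_intros]:
  fixes f :: "'a::topological_space \<Rightarrow> complex ^ 'n ^ 'm"
  shows "continuous_on S f \<Longrightarrow> continuous_on S g \<Longrightarrow> continuous_on S (\<lambda>x. f x *v g x)"
  unfolding matrix_vector_mult_def by (intro continuous_intros)

lemma hinner_adjoint: "hinner x (A *v y) = hinner (adjoint_mat A *v x) y"
  unfolding hinner_def matrix_vector_mult_def adjoint_mat_def
  by (simp add: sum_distrib_left sum_distrib_right transpose_def map_matrix_def)
     (subst sum.swap, simp add: algebra_simps)

lemma hinner_hermitian: "hermitian A \<Longrightarrow> hinner x (A *v y) = hinner (A *v x) y"
  by (simp add: hinner_adjoint hermitian_def)

lemma adjoint_adjoint [simp]: "adjoint_mat (adjoint_mat A) = A"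
  by (simp add: adjoint_mat_def map_matrix_def transpose_def vec_eq_iff)

lemma adjoint_mult: "adjoint_mat (A ** B) = adjoint_mat B ** adjoint_mat A"
  by (simp add: adjoint_mat_def map_matrix_def transpose_def vec_eq_iff matrix_matrix_mult_def
      mult.commute)

lemma adjoint_add: "adjoint_mat (A + B) = adjoint_mat A + adjoint_mat B"
  by (simp add: adjoint_mat_def map_matrix_def transpose_def vec_eq_iff)

lemma adjoint_diff: "adjoint_mat (A - B) = adjoint_mat A - adjoint_mat B"
  by (simp add: adjoint_mat_def map_matrix_def transpose_def vec_eq_iff)

lemma adjoint_zero [simp]: "adjoint_mat 0 = 0"
  by (simp add: adjoint_mat_def map_matrix_def transpose_def vec_eq_iff)

lemma adjoint_scaleR: "adjoint_mat (t *\<^sub>R A) = t *\<^sub>R adjoint_mat A"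
  by (simp add: adjoint_mat_def map_matrix_def transpose_def vec_eq_iff)

lemma adjoint_sum: "adjoint_mat (\<Sum>k\<in>I. f k) = (\<Sum>k\<in>I. adjoint_mat (f k))"
  by (induction I rule: infinite_finite_induct) (auto simp: adjoint_add)

lemma hermitian_diff: "hermitian A \<Longrightarrow> hermitian B \<Longrightarrow> hermitian (A - B)"
  by (simp add: hermitian_def adjoint_diff)

lemma hermitian_scaleR: "hermitian A \<Longrightarrow> hermitian (t *\<^sub>R A)"
  by (simp add: hermitian_def adjoint_scaleR)

lemma hermitian_sum: "(\<And>k. k \<in> I \<Longrightarrow> hermitian (f k)) \<Longrightarrow> hermitian (\<Sum>k\<in>I. f k)"
  by (simp add: hermitian_def adjoint_sum)

lemma hermitian_mat_of_real: "hermitian (mat (of_real t))"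
  by (simp add: hermitian_def adjoint_mat_def map_matrix_def transpose_def mat_def vec_eq_iff)

lemma matrix_sum_mult_vec: "(\<Sum>k\<in>I. f k) *v x = (\<Sum>k\<in>I. f k *v x)"
  for f :: "_ \<Rightarrow> complex ^ 'n ^ 'm"
  by (induction I rule: infinite_finite_induct) (auto simp: matrix_vector_mult_add_rdistrib)

lemma matrix_scaleR_mult_vec: "(t *\<^sub>R A) *v x = t *\<^sub>R (A *v x)"
  for A :: "complex ^ 'n ^ 'm"
  by (simp add: matrix_vector_mult_def vec_eq_iff scaleR_sum_right)

lemma matrix_mult_vec_scaleR: "A *v (t *\<^sub>R x) = t *\<^sub>R (A *v x)"
  for A :: "complex ^ 'n ^ 'm"
  by (simp add: matrix_vector_mult_def vec_eq_iff scaleR_sum_right)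

lemma mat_of_real_mult_vec: "mat (of_real t) *v x = t *\<^sub>R x"
  for x :: "complex ^ 'n"
proof -
  have "mat (of_real t) = t *\<^sub>R (mat 1 :: complex ^ 'n ^ 'n)"
    by (simp add: mat_def vec_eq_iff scaleR_conv_of_real[where 'a=complex])
  then show ?thesis by (simp add: matrix_scaleR_mult_vec)
qed

lemma matrix_mult_sum_right: "A ** (\<Sum>k\<in>I. f k) = (\<Sum>k\<in>I. A ** f k)"
  for A :: "complex ^ 'n ^ 'm"
  by (induction I rule: infinite_finite_induct) (auto simp: matrix_add_ldistrib)

lemma matrix_mult_sum_left: "(\<Sum>k\<in>I. f k) ** A = (\<Sum>k\<in>I. f k ** A)"
  for A :: "complex ^ 'n ^ 'm"
  by (induction I rule: infinite_finite_induct)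
     (auto simp: matrix_matrix_mult_def vec_eq_iff algebra_simps sum.distrib)

lemma trace_sum: "trace (\<Sum>k\<in>I. f k) = (\<Sum>k\<in>I. trace (f k))"
  for f :: "_ \<Rightarrow> complex ^ 'n ^ 'n"
  by (induction I rule: infinite_finite_induct) (auto simp: trace_def sum.distrib)

lemma trace_mult_scaleR: "trace (A ** (t *\<^sub>R B)) = of_real t * trace (A ** B)"
  for A :: "complex ^ 'n ^ 'n"
  by (simp add: trace_def matrix_matrix_mult_def sum_distrib_left scaleR_conv_of_real[where 'a=complex] algebra_simps)

definition outer :: "complex ^ 'm \<Rightarrow> complex ^ 'n \<Rightarrow> complex ^ 'n ^ 'm" where
  "outer a b = (\<chi> i j. a $ i * cnj (b $ j))"

lemma outer_mult_vec: "outer a b *v x = hinner b x *s a"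
  by (simp add: outer_def matrix_vector_mult_def hinner_def vec_eq_iff sum_distrib_right sum_distrib_left mult_ac)

lemma adjoint_outer [simp]: "adjoint_mat (outer a b) = outer b a"
  by (simp add: outer_def adjoint_mat_def map_matrix_def transpose_def vec_eq_iff)

lemma hermitian_outer: "hermitian (outer a a)"
  by (simp add: hermitian_def)

lemma matrix_mult_outer: "A ** outer a b = outer (A *v a) b"
  by (simp add: outer_def matrix_matrix_mult_def matrix_vector_mult_def vec_eq_iff
      sum_distrib_right mult.assoc)

lemma trace_outer: "trace (outer a b) = hinner b a"
  by (simp add: outer_def trace_def hinner_def mult.commute)

lemma norm_outer: "norm (outer a b) = norm a * norm b"
proof -
  have "norm (outer a b $ i) = norm (a $ i) * norm b" for i
    by (simp add: outer_def norm_vec_def norm_mult L2_set_right_distrib)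
  then show ?thesis
    by (simp add: norm_vec_def[of "outer a b"] norm_vec_def[of a] L2_set_left_distrib)
qed

section \<open>The spectral theorem for Hermitian matrices\<close>

text \<open>If \<open>B x\<close> were nonzero, the value \<open>0\<close> of the form at \<open>x\<close> would grow at the rate
  \<open>2 * \<parallel>B x\<parallel>\<^sup>2 > 0\<close> in the direction \<open>B x\<close>. Only points of the line through \<open>x\<close> in this
  direction are tested, so that the lemma applies on subspaces invariant under \<open>B\<close> as well.\<close>

lemma hermitian_form_extremal:
  assumes B: "hermitian B" and zero: "Re (hinner x (B *v x)) = 0"
    and nonpos: "\<And>t::real. Re (hinner (x + t *\<^sub>R (B *v x)) (B *v (x + t *\<^sub>R (B *v x)))) \<le> 0"
  shows "B *v x = 0"
proof (rule ccontr)
  assume "B *v x \<noteq> 0"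
  define a where "a = (norm (B *v x))\<^sup>2"
  define c where "c = Re (hinner (B *v x) (B *v (B *v x)))"
  have a: "a > 0" using \<open>B *v x \<noteq> 0\<close> by (simp add: a_def)
  have eq: "Re (hinner (x + t *\<^sub>R (B *v x)) (B *v (x + t *\<^sub>R (B *v x)))) = 2 * t * a + t\<^sup>2 * c"
    for t :: real
    using zero hinner_hermitian[OF B, of x "B *v x"]
    by (simp add: matrix_vector_right_distrib matrix_mult_vec_scaleR hinner_add_left
        hinner_add_right hinner_scaleR_left hinner_scaleR_right a_def c_def hinner_self
        power2_eq_square algebra_simps)
  \<comment> \<open>so small a step that the quadratic term cannot compensate the linear one\<close>
  define t where "t = a / (1 + \<bar>c\<bar>)"
  have t: "t > 0" using a by (simp add: t_def)
  have "t * \<bar>c\<bar> < a" using a by (simp add: t_def field_simps)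
  then have "2 * a + t * c > 0" using a t abs_mult[of t c] by (smt (verit))
  then have "t * (2 * a + t * c) > 0" using t by simp
  then show False using nonpos[of t] unfolding eq by (simp add: power2_eq_square algebra_simps)
qed

text \<open>The orthogonal complement of a set of eigenvectors is invariant under \<open>X\<close>, and a maximiser of
  the Rayleigh quotient on its unit sphere is an eigenvector by \<open>hermitian_form_extremal\<close>. The vector
  \<open>w\<close> ensures that the complement is not zero.\<close>

lemma hermitian_eigenvector_orthogonal:
  assumes X: "hermitian X" and E: "\<And>b. b \<in> E \<Longrightarrow> \<exists>l::real. X *v b = l *\<^sub>R b"
    and w: "w \<noteq> 0" "\<And>b. b \<in> E \<Longrightarrow> hinner b w = 0"
  shows "\<exists>x (l::real). hinner x x = 1 \<and> (\<forall>b\<in>E. hinner b x = 0) \<and> X *v x = l *\<^sub>R x"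
proof -
  define S where "S = {x. \<forall>b\<in>E. hinner b x = 0}"
  have S_comb: "x + t *\<^sub>R y \<in> S" if "x \<in> S" "y \<in> S" for x y and t :: real
    using that by (auto simp: S_def hinner_add_right hinner_scaleR_right)
  have S_scale: "t *\<^sub>R y \<in> S" if "y \<in> S" for y and t :: real
    using that by (auto simp: S_def hinner_scaleR_right)
  have S_X: "X *v x \<in> S" if "x \<in> S" for x
  proof -
    have "hinner b (X *v x) = 0" if "b \<in> E" for b
      using E[OF that] \<open>x \<in> S\<close> \<open>b \<in> E\<close>
      by (auto simp: S_def hinner_hermitian[OF X] hinner_scaleR_left)
    then show ?thesis by (simp add: S_def)
  qed
  have "closed S"
    unfolding S_def Collect_ball_eq
    by (intro closed_INT ballI closed_Collect_eq continuous_intros)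
  then have comp: "compact (S \<inter> sphere 0 1)"
    by (simp add: closed_Int_compact)
  have ne: "S \<inter> sphere 0 1 \<noteq> {}"
  proof -
    have "(1 / norm w) *\<^sub>R w \<in> S \<inter> sphere 0 1"
      using w S_scale[of w] by (auto simp: S_def)
    then show ?thesis by blast
  qed
  have "continuous_on (S \<inter> sphere 0 1) (\<lambda>x. Re (hinner x (X *v x)))"
    by (intro continuous_intros)
  from continuous_attains_sup[OF comp ne this] obtain x where
    x: "x \<in> S" "norm x = 1" and
    max: "\<And>y. y \<in> S \<Longrightarrow> norm y = 1 \<Longrightarrow> Re (hinner y (X *v y)) \<le> Re (hinner x (X *v x))"
    by auto
  define l where "l = Re (hinner x (X *v x))"
  \<comment> \<open>the form of \<open>B\<close> is nonpositive on \<open>S\<close> and vanishes at the maximiser\<close>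
  define B where "B = X - mat (of_real l)"
  have Bv: "B *v y = X *v y - l *\<^sub>R y" for y
    by (simp add: B_def matrix_vector_mult_diff_rdistrib mat_of_real_mult_vec)
  have nonpos: "Re (hinner y (B *v y)) \<le> 0" if "y \<in> S" for y
  proof (cases "y = 0")
    case False
    have "Re (hinner ((1 / norm y) *\<^sub>R y) (X *v ((1 / norm y) *\<^sub>R y))) \<le> l"
      unfolding l_def using False by (intro max S_scale that) auto
    then have "Re (hinner y (X *v y)) \<le> l * (norm y)\<^sup>2"
      using False by (simp add: matrix_mult_vec_scaleR hinner_scaleR_left hinner_scaleR_right
          field_simps power2_eq_square)
    then show ?thesis
      by (simp add: Bv hinner_diff_right hinner_scaleR_right hinner_self)
  qed simp
  have "B *v x = 0"
  proof (rule hermitian_form_extremal)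
    show "hermitian B"
      unfolding B_def by (intro hermitian_diff X hermitian_mat_of_real)
    show "Re (hinner x (B *v x)) = 0"
      using x by (simp add: Bv hinner_diff_right hinner_scaleR_right hinner_self l_def)
    have "B *v x \<in> S"
      using S_comb[OF S_X[OF x(1)] x(1), of "- l"] by (simp add: Bv)
    then show "Re (hinner (x + t *\<^sub>R (B *v x)) (B *v (x + t *\<^sub>R (B *v x)))) \<le> 0" for t :: real
      by (intro nonpos S_comb x)
  qed
  then have "X *v x = l *\<^sub>R x" by (simp add: Bv)
  moreover have "hinner x x = 1" using x by (simp add: hinner_self)
  ultimately show ?thesis using x by (auto simp: S_def)
qed

lemma hermitian_orthonormal_eigenvectors:
  fixes X :: "complex ^ 'n ^ 'n"
  assumes X: "hermitian X" and "k \<le> CARD('n)"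
  shows "\<exists>E. finite E \<and> card E = k \<and> (\<forall>a\<in>E. \<forall>b\<in>E. hinner a b = (if a = b then 1 else 0))
    \<and> (\<forall>b\<in>E. \<exists>l::real. X *v b = l *\<^sub>R b)"
  using assms(2)
proof (induction k)
  case 0
  show ?case by (intro exI[of _ "{}"]) auto
next
  case (Suc k)
  then obtain E where E: "finite E" "card E = k"
    "\<And>a b. a \<in> E \<Longrightarrow> b \<in> E \<Longrightarrow> hinner a b = (if a = b then 1 else 0)"
    "\<And>b. b \<in> E \<Longrightarrow> \<exists>l::real. X *v b = l *\<^sub>R b" by auto
  have "vec.span E \<noteq> UNIV"
  proof
    assume "vec.span E = UNIV"
    then have "vec.dim (UNIV :: (complex ^ 'n) set) \<le> card E"
      using E(1) by (intro vec.dim_le_card) auto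
    then show False using Suc.prems E(2) vec_dim_card[where 'a=complex and 'n='n] by auto
  qed
  then obtain z where z: "z \<notin> vec.span E" by auto
  \<comment> \<open>the Gram-Schmidt step\<close>
  define w where "w = z - (\<Sum>b\<in>E. hinner b z *s b)"
  have "w \<noteq> 0"
  proof
    assume "w = 0"
    then have "z = (\<Sum>b\<in>E. hinner b z *s b)" by (simp add: w_def)
    also have "\<dots> \<in> vec.span E"
      by (intro vec.span_sum vec.span_scale vec.span_base)
    finally show False using z by simp
  qed
  moreover have "hinner b w = 0" if "b \<in> E" for b
  proof -
    have "(\<Sum>a\<in>E. hinner a z * hinner b a) = (\<Sum>a\<in>E. if b = a then hinner a z else 0)"
      using E(3) that by (intro sum.cong) auto
    then show ?thesis
      using that E(1) by (simp add: w_def hinner_diff_right hinner_sum_right hinner_scale_right)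
  qed
  ultimately obtain x l where x: "hinner x x = 1" "\<forall>b\<in>E. hinner b x = 0" "X *v x = (l::real) *\<^sub>R x"
    using hermitian_eigenvector_orthogonal[OF X, of E w] E(4) by blast
  have x': "hinner x b = 0" if "b \<in> E" for b
    using x(2) that cnj_hinner[of b x] by simp
  have "x \<notin> E" using x by auto
  show ?case
  proof (intro exI[of _ "insert x E"] conjI)
    show "card (insert x E) = Suc k" using E \<open>x \<notin> E\<close> by simp
    show "\<forall>a\<in>insert x E. \<forall>b\<in>insert x E. hinner a b = (if a = b then 1 else 0)"
      using E(3) x x' \<open>x \<notin> E\<close> by auto
    show "\<forall>b\<in>insert x E. \<exists>l::real. X *v b = l *\<^sub>R b"
      using E(4) x(3) by auto
  qed (use E in auto)
qed

text \<open>A family indexed by the coordinates themselves has the right number of members, so orthonormality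
  alone makes it a basis.\<close>

definition orthonormal_basis :: "('n \<Rightarrow> complex ^ 'n) \<Rightarrow> bool" where
  "orthonormal_basis e \<longleftrightarrow> (\<forall>i j. hinner (e i) (e j) = (if i = j then 1 else 0))"

text \<open>The matrix with columns \<open>e k\<close> has its adjoint as a left inverse, hence, being square, as a
  right inverse too.\<close>

lemma orthonormal_basis_expansion:
  assumes "orthonormal_basis e"
  shows "x = (\<Sum>k\<in>UNIV. hinner (e k) x *s e k)" and "(\<Sum>k\<in>UNIV. outer (e k) (e k)) = mat 1"
proof -
  define U where "U = (\<chi> i k. e k $ i)"
  have "adjoint_mat U ** U = mat 1"
    using assms by (simp add: orthonormal_basis_def vec_eq_iff matrix_matrix_mult_def U_def
        adjoint_mat_def map_matrix_def transpose_def mat_def hinner_def)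
  then have "U ** adjoint_mat U = mat 1"
    by (rule matrix_left_right_inverse[THEN iffD1])
  moreover have "U ** adjoint_mat U = (\<Sum>k\<in>UNIV. outer (e k) (e k))"
    by (simp add: vec_eq_iff matrix_matrix_mult_def U_def outer_def
        adjoint_mat_def map_matrix_def transpose_def)
  ultimately show 1: "(\<Sum>k\<in>UNIV. outer (e k) (e k)) = mat 1" by simp
  have "x = (\<Sum>k\<in>UNIV. outer (e k) (e k)) *v x" by (simp add: 1)
  then show "x = (\<Sum>k\<in>UNIV. hinner (e k) x *s e k)"
    by (simp add: matrix_sum_mult_vec outer_mult_vec)
qed

lemma map_matrix_const_poly_mult:
  fixes A B :: "complex ^ 'n ^ 'n"
  shows "map_matrix (\<lambda>c. [:c:]) (A ** B) = map_matrix (\<lambda>c. [:c:]) A ** map_matrix (\<lambda>c. [:c:]) B"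
proof -
  have "[:\<Sum>k\<in>UNIV. f k:] = (\<Sum>k\<in>UNIV. [:f k:])" for f :: "'n \<Rightarrow> complex"
    by (simp add: poly_eq_iff coeff_sum coeff_pCons split: nat.split)
  then show ?thesis
    by (simp add: map_matrix_def vec_eq_iff matrix_matrix_mult_def mult.commute)
qed

text \<open>With \<open>U\<close> the matrix of eigenvectors and \<open>D\<close> the diagonal matrix of the \<open>l k\<close>, the equation
  \<open>X U = U D\<close> is lifted to matrices of polynomials, where it gives
  \<open>(t - X) U = U (t - D)\<close>. Taking determinants and cancelling the nonzero \<open>det U\<close>, the characteristic
  polynomial is that of \<open>D\<close>.\<close>

lemma eigvals_orthonormal_eigenbasis:
  fixes X :: "complex ^ 'n ^ 'n" and l :: "'n \<Rightarrow> real"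
  assumes e: "orthonormal_basis e" and X: "\<And>k. X *v e k = l k *\<^sub>R e k"
  shows "eigvals X = image_mset (\<lambda>k. complex_of_real (l k)) (mset_set UNIV)"
proof -
  define U where "U = (\<chi> i k. e k $ i)"
  define D :: "complex ^ 'n ^ 'n" where "D = (\<chi> i j. if i = j then of_real (l i) else 0)"
  define P where "P A = map_matrix (\<lambda>c. [:c:]) A" for A :: "complex ^ 'n ^ 'n"
  have U: "adjoint_mat U ** U = mat 1"
    using e by (simp add: orthonormal_basis_def vec_eq_iff matrix_matrix_mult_def U_def
        adjoint_mat_def map_matrix_def transpose_def mat_def hinner_def)
  have XU: "X ** U = U ** D"
  proof -
    have "(X ** U) $ i $ k = (X *v e k) $ i" for i k
      by (simp add: matrix_matrix_mult_def matrix_vector_mult_def U_def)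
    moreover have "(U ** D) $ i $ k = (l k *\<^sub>R e k) $ i" for i k
      by (simp add: matrix_matrix_mult_def U_def D_def if_distrib scaleR_conv_of_real[where 'a=complex] mult.commute
          cong: if_cong)
    ultimately show ?thesis by (simp add: vec_eq_iff X)
  qed
  have P1: "P (mat 1) = mat 1"
    by (simp add: P_def map_matrix_def mat_def vec_eq_iff one_pCons)
  have Pm: "P (A ** B) = P A ** P B" for A B
    by (simp add: P_def map_matrix_const_poly_mult)
  have comm: "mat [:0, 1:] ** M = M ** mat [:0, 1:]" for M :: "complex poly ^ 'n ^ 'n"
    by (simp add: matrix_matrix_mult_def mat_def vec_eq_iff if_distrib if_distribR mult.commute
        cong: if_cong)
  have "(mat [:0, 1:] - P X) ** P U = P U ** (mat [:0, 1:] - P D)"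
  proof -
    have "(mat [:0, 1:] - P X) ** P U = mat [:0, 1:] ** P U - P X ** P U"
      by (simp add: matrix_matrix_mult_def vec_eq_iff algebra_simps sum_subtractf)
    also have "\<dots> = P U ** mat [:0, 1:] - P U ** P D"
      by (simp add: comm XU flip: Pm)
    also have "\<dots> = P U ** (mat [:0, 1:] - P D)"
      by (simp add: matrix_matrix_mult_def vec_eq_iff algebra_simps sum_subtractf)
    finally show ?thesis .
  qed
  then have "det (mat [:0, 1:] - P X) * det (P U) = det (P U) * det (mat [:0, 1:] - P D)"
    by (metis det_mul)
  moreover have "det (P U) \<noteq> 0"
  proof -
    have "det (P (adjoint_mat U)) * det (P U) = 1"
      by (metis P1 Pm U det_mul det_I)
    then show ?thesis by auto
  qed
  ultimately have "charpoly X = det (mat [:0, 1:] - P D)"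
    by (simp add: charpoly_def P_def mult.commute)
  also have "\<dots> = (\<Prod>k\<in>UNIV. (mat [:0, 1:] - P D) $ k $ k)"
    by (rule det_diagonal) (simp add: P_def map_matrix_def mat_def D_def)
  also have "\<dots> = (\<Prod>k\<in>UNIV. [:- complex_of_real (l k), 1:])"
    by (simp add: P_def map_matrix_def mat_def D_def)
  finally have "charpoly X = (\<Prod>k\<in>UNIV. [:- complex_of_real (l k), 1:])" .
  then have "eigvals X = (\<Sum>k\<in>UNIV. proots [:- complex_of_real (l k), 1:])"
    unfolding eigvals_def by (simp add: proots_prod)
  also have "\<dots> = (\<Sum>k\<in>UNIV. {#complex_of_real (l k)#})"
    by simp
  finally show ?thesis by (simp add: sum_unfold_sum_mset) 
qed

theorem hermitian_spectral:
  fixes X :: "complex ^ 'n ^ 'n"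
  assumes "hermitian X"
  obtains e :: "'n \<Rightarrow> complex ^ 'n" and l :: "'n \<Rightarrow> real"
  where "orthonormal_basis e" "X = (\<Sum>k\<in>UNIV. l k *\<^sub>R outer (e k) (e k))"
    "eigvals X = image_mset (\<lambda>k. complex_of_real (l k)) (mset_set UNIV)"
proof -
  obtain E where E: "finite E" "card E = CARD('n)"
    "\<And>a b. a \<in> E \<Longrightarrow> b \<in> E \<Longrightarrow> hinner a b = (if a = b then 1 else 0)"
    "\<And>b. b \<in> E \<Longrightarrow> \<exists>l::real. X *v b = l *\<^sub>R b"
    using hermitian_orthonormal_eigenvectors[OF assms order_refl] by auto
  then obtain e :: "'n \<Rightarrow> complex ^ 'n" where e: "bij_betw e UNIV E"
    by (metis finite_class.finite_UNIV finite_same_card_bij)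
  then have eE: "e k \<in> E" for k by (auto simp: bij_betw_def)
  have ob: "orthonormal_basis e"
    using e eE E(3) by (auto simp: orthonormal_basis_def bij_betw_def inj_def)
  obtain l :: "'n \<Rightarrow> real" where l: "\<And>k. X *v e k = l k *\<^sub>R e k"
    using E(4)[OF eE] by metis
  have "X = X ** (\<Sum>k\<in>UNIV. outer (e k) (e k))"
    by (simp add: orthonormal_basis_expansion[OF ob])
  also have "\<dots> = (\<Sum>k\<in>UNIV. l k *\<^sub>R outer (e k) (e k))"
    unfolding matrix_mult_sum_right matrix_mult_outer l
    by (intro sum.cong) (simp_all add: outer_def vec_eq_iff)
  finally show ?thesis
    using that ob eigvals_orthonormal_eigenbasis[OF ob l] by blast
qed

section \<open>Extremal descriptions of the eigenvalues and of the trace norm\<close>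

abbreviation qform :: "complex ^ 'n ^ 'n \<Rightarrow> complex ^ 'n \<Rightarrow> real" where
  "qform X x \<equiv> Re (hinner x (X *v x))"

lemma hinner_mult_cnj: "hinner x y * hinner y x = of_real ((cmod (hinner x y))\<^sup>2)"
  by (metis cnj_hinner complex_norm_square)

lemma spectral_sum_mult_vec:
  "(\<Sum>k\<in>UNIV. l k *\<^sub>R outer (e k) (e k)) *v x = (\<Sum>k\<in>UNIV. l k *\<^sub>R (hinner (e k) x *s e k))"
  by (simp add: matrix_sum_mult_vec matrix_scaleR_mult_vec outer_mult_vec)

lemma hinner_spectral_sum:
  "hinner x ((\<Sum>k\<in>UNIV. l k *\<^sub>R outer (e k) (e k)) *v x)
    = of_real (\<Sum>k\<in>UNIV. l k * (cmod (hinner (e k) x))\<^sup>2)"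
  by (simp add: spectral_sum_mult_vec hinner_sum_right hinner_scaleR_right hinner_scale_right
      hinner_mult_cnj)

lemma orthonormal_basis_Parseval:
  assumes "orthonormal_basis e"
  shows "(norm x)\<^sup>2 = (\<Sum>k\<in>UNIV. (cmod (hinner (e k) x))\<^sup>2)"
proof -
  have "complex_of_real ((norm x)\<^sup>2) = hinner x (\<Sum>k\<in>UNIV. hinner (e k) x *s e k)"
    using orthonormal_basis_expansion(1)[OF assms, of x] by (metis hinner_self)
  also have "\<dots> = of_real (\<Sum>k\<in>UNIV. (cmod (hinner (e k) x))\<^sup>2)"
    by (simp add: hinner_sum_right hinner_scale_right hinner_mult_cnj)
  finally show ?thesis by (simp only: of_real_eq_iff)
qed

lemma hermitian_spectral_sum: "hermitian (\<Sum>k\<in>UNIV. l k *\<^sub>R outer (e k) (e k))"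
  by (intro hermitian_sum hermitian_scaleR hermitian_outer)

lemma orthonormal_basis_norm:
  assumes "orthonormal_basis e"
  shows "norm (e k) = 1"
proof -
  have "complex_of_real ((norm (e k))\<^sup>2) = 1"
    using hinner_self[of "e k"] assms unfolding orthonormal_basis_def by metis
  then have "(norm (e k))\<^sup>2 = 1" by (simp only: of_real_eq_1_iff)
  then show ?thesis using norm_ge_zero[of "e k"] by (simp add: power2_eq_1_iff)
qed

lemma qform_spectral_sum_basis:
  assumes "orthonormal_basis e"
  shows "qform (\<Sum>k\<in>UNIV. l k *\<^sub>R outer (e k) (e k)) (e j) = l j"
proof -
  have "(\<Sum>k\<in>UNIV. l k * (cmod (hinner (e k) (e j)))\<^sup>2) = (\<Sum>k\<in>UNIV. if k = j then l k else 0)"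
    using assms by (intro sum.cong) (auto simp: orthonormal_basis_def)
  then show ?thesis by (simp add: hinner_spectral_sum)
qed

lemma qform_mat: "qform (mat (of_real t)) x = t * (norm x)\<^sup>2"
  by (simp add: mat_of_real_mult_vec hinner_scaleR_right hinner_self)

lemma qform_diff: "qform (A - B) x = qform A x - qform B x"
  by (simp add: matrix_vector_mult_diff_rdistrib hinner_diff_right)

lemma qform_scaleR: "qform (t *\<^sub>R A) x = t * qform A x"
  by (simp add: matrix_scaleR_mult_vec hinner_scaleR_right)

text \<open>In an orthonormal eigenbasis the form is the sum of the eigenvalues, weighted by the squared
  moduli of the coordinates of \<open>x\<close>.\<close>

lemma
  fixes X :: "complex ^ 'n ^ 'n"
  assumes "hermitian X"
  shows qform_le_lambda_max: "qform X x \<le> lambda_max X * (norm x)\<^sup>2"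
    and lambda_min_le_qform: "lambda_min X * (norm x)\<^sup>2 \<le> qform X x"
    and lambda_max_attained: "\<exists>y. norm y = 1 \<and> qform X y = lambda_max X"
    and lambda_min_attained: "\<exists>y. norm y = 1 \<and> qform X y = lambda_min X"
    and lambda_eq_imp_scalar: "lambda_max X = lambda_min X \<Longrightarrow> X = mat (of_real (lambda_min X))"
proof -
  obtain e :: "'n \<Rightarrow> complex ^ 'n" and l :: "'n \<Rightarrow> real" where e: "orthonormal_basis e"
    and X: "X = (\<Sum>k\<in>UNIV. l k *\<^sub>R outer (e k) (e k))"
    and ev: "eigvals X = image_mset (\<lambda>k. complex_of_real (l k)) (mset_set UNIV)"
    using hermitian_spectral[OF assms] by blast
  have "Re ` set_mset (eigvals X) = range l"
    by (auto simp: ev image_image)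
  then have max: "lambda_max X = Max (range l)" and min: "lambda_min X = Min (range l)"
    by (simp_all add: lambda_max_def lambda_min_def)
  have q: "qform X x = (\<Sum>k\<in>UNIV. l k * (cmod (hinner (e k) x))\<^sup>2)" for x
    by (simp add: X hinner_spectral_sum)
  show "qform X x \<le> lambda_max X * (norm x)\<^sup>2"
    unfolding q orthonormal_basis_Parseval[OF e] sum_distrib_left max
    by (intro sum_mono mult_right_mono) auto
  show "lambda_min X * (norm x)\<^sup>2 \<le> qform X x"
    unfolding q orthonormal_basis_Parseval[OF e] sum_distrib_left min
    by (intro sum_mono mult_right_mono) auto
  have qe: "norm (e j) = 1 \<and> qform X (e j) = l j" for j
    by (simp only: X qform_spectral_sum_basis[OF e] orthonormal_basis_norm[OF e])
  have "Max (range l) \<in> range l" "Min (range l) \<in> range l"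
    by (intro Max_in Min_in; simp)+
  then show "\<exists>y. norm y = 1 \<and> qform X y = lambda_max X" "\<exists>y. norm y = 1 \<and> qform X y = lambda_min X"
    unfolding max min using qe by (metis imageE)+
  assume eq: "lambda_max X = lambda_min X"
  have "l k = lambda_min X" for k
  proof -
    have "l k \<le> Max (range l)" "Min (range l) \<le> l k" by simp_all
    then show ?thesis using eq unfolding max min by linarith
  qed
  then have "X = lambda_min X *\<^sub>R (\<Sum>k\<in>UNIV. outer (e k) (e k))"
    by (subst X) (simp add: scaleR_sum_right)
  then show "X = mat (of_real (lambda_min X))"
    by (simp add: orthonormal_basis_expansion(2)[OF e] mat_def vec_eq_iff scaleR_conv_of_real[where 'a=complex])
qed

lemma lambda_min_less_lambda_max:
  assumes "hermitian X" "X \<notin> range (\<lambda>t::real. mat (of_real t))"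
  shows "lambda_min X < lambda_max X"
proof -
  obtain y where y: "norm y = 1" "qform X y = lambda_max X"
    using lambda_max_attained[OF assms(1)] by blast
  then have "lambda_min X \<le> lambda_max X"
    using lambda_min_le_qform[OF assms(1), of y] by simp
  moreover have "lambda_max X \<noteq> lambda_min X"
    using lambda_eq_imp_scalar[OF assms(1)] assms(2) by blast
  ultimately show ?thesis by simp
qed

lemma trace_mult_spectral_sum:
  "Re (trace (X ** (\<Sum>k\<in>UNIV. l k *\<^sub>R outer (e k) (e k)))) = (\<Sum>k\<in>UNIV. l k * qform X (e k))"
  by (simp add: matrix_mult_sum_right trace_sum trace_mult_scaleR matrix_mult_outer trace_outer)

text \<open>The trace norm is dual to the operator norm: if \<open>A\<close> has eigenvalues \<open>l k\<close> with eigenvectors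
  \<open>e k\<close>, the trace of \<open>X A\<close> is the sum of the \<open>l k\<close> weighted by the values of the form of \<open>X\<close> at
  \<open>e k\<close>, which lie between \<open>-1\<close> and \<open>1\<close>. The sign of \<open>A\<close> is the optimal \<open>X\<close>.\<close>

lemma
  fixes A :: "complex ^ 'n ^ 'n"
  assumes "hermitian A"
  shows trace_mult_le_trace_norm:
      "\<And>X. (\<And>x. \<bar>qform X x\<bar> \<le> (norm x)\<^sup>2) \<Longrightarrow> Re (trace (X ** A)) \<le> trace_norm A"
    and trace_norm_attained:
      "\<exists>X. hermitian X \<and> (\<forall>x. \<bar>qform X x\<bar> \<le> (norm x)\<^sup>2) \<and> Re (trace (X ** A)) = trace_norm A"
proof -
  obtain e :: "'n \<Rightarrow> complex ^ 'n" and l :: "'n \<Rightarrow> real" where e: "orthonormal_basis e"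
    and A: "A = (\<Sum>k\<in>UNIV. l k *\<^sub>R outer (e k) (e k))"
    and ev: "eigvals A = image_mset (\<lambda>k. complex_of_real (l k)) (mset_set UNIV)"
    using hermitian_spectral[OF assms] by blast
  have tn: "trace_norm A = (\<Sum>k\<in>UNIV. \<bar>l k\<bar>)"
    by (simp add: trace_norm_def ev image_mset.compositionality o_def sum_unfold_sum_mset)
  show "Re (trace (X ** A)) \<le> trace_norm A" if "\<And>x. \<bar>qform X x\<bar> \<le> (norm x)\<^sup>2" for X
  proof -
    have "l k * qform X (e k) \<le> \<bar>l k\<bar>" for k
    proof -
      have "\<bar>qform X (e k)\<bar> \<le> 1"
        using that[of "e k"] by (simp add: orthonormal_basis_norm[OF e])
      then have "\<bar>l k\<bar> * \<bar>qform X (e k)\<bar> \<le> \<bar>l k\<bar>"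
        by (intro mult_left_le) auto
      then show ?thesis by (metis abs_mult abs_ge_self order_trans)
    qed
    then show ?thesis
      unfolding tn by (subst A) (simp only: trace_mult_spectral_sum sum_mono)
  qed
  define X where "X = (\<Sum>k\<in>UNIV. sgn (l k) *\<^sub>R outer (e k) (e k))"
  have "\<bar>qform X x\<bar> \<le> (norm x)\<^sup>2" for x
  proof -
    have "qform X x = (\<Sum>k\<in>UNIV. sgn (l k) * (cmod (hinner (e k) x))\<^sup>2)"
      by (simp add: X_def hinner_spectral_sum)
    also have "\<bar>\<dots>\<bar> \<le> (\<Sum>k\<in>UNIV. \<bar>sgn (l k) * (cmod (hinner (e k) x))\<^sup>2\<bar>)"
      by (rule sum_abs)
    also have "\<dots> \<le> (\<Sum>k\<in>UNIV. (cmod (hinner (e k) x))\<^sup>2)"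
      by (intro sum_mono) (simp add: abs_mult sgn_if)
    finally show ?thesis by (simp add: orthonormal_basis_Parseval[OF e])
  qed
  moreover have "Re (trace (X ** A)) = trace_norm A"
  proof -
    have qX: "qform X (e k) = sgn (l k)" for k
      unfolding X_def by (rule qform_spectral_sum_basis[OF e])
    have "Re (trace (X ** A)) = (\<Sum>k\<in>UNIV. l k * qform X (e k))"
      by (subst A) (rule trace_mult_spectral_sum)
    also have "\<dots> = trace_norm A"
      unfolding qX tn abs_sgn ..
    finally show ?thesis .
  qed
  moreover have "hermitian X"
    unfolding X_def by (rule hermitian_spectral_sum)
  ultimately show "\<exists>X. hermitian X \<and> (\<forall>x. \<bar>qform X x\<bar> \<le> (norm x)\<^sup>2) \<and> Re (trace (X ** A)) = trace_norm A"
    by (intro exI[of _ X] conjI allI)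
qed

lemma trace_norm_nonneg: "hermitian A \<Longrightarrow> 0 \<le> trace_norm A"
  using trace_mult_le_trace_norm[of A 0] by (simp add: trace_def)

section \<open>Effects and projections\<close>

text \<open>The Hermitian matrices with spectrum in \<open>[0, 1]\<close>, called effects in quantum theory.\<close>

definition effects :: "(complex ^ 'n ^ 'n) set" where
  "effects = {X. hermitian X \<and> (\<forall>x. 0 \<le> qform X x \<and> qform X x \<le> (norm x)\<^sup>2)}"

text \<open>Boundedness: all eigenvalues lie in \<open>[0, 1]\<close>, so in the spectral decomposition each of the
  \<open>CARD('n)\<close> summands has norm at most 1.\<close>

lemma compact_effects: "compact (effects :: (complex ^ 'n ^ 'n) set)"
  unfolding compact_eq_bounded_closed
proof
  have "continuous_on UNIV (adjoint_mat :: complex ^ 'n ^ 'n \<Rightarrow> _)"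
    unfolding adjoint_mat_def map_matrix_def transpose_def
    by (simp, intro continuous_intros)
  then have "closed {X :: complex ^ 'n ^ 'n. hermitian X}"
    unfolding hermitian_def by (intro closed_Collect_eq continuous_intros)
  moreover have "closed {X :: complex ^ 'n ^ 'n. \<forall>x. 0 \<le> qform X x \<and> qform X x \<le> (norm x)\<^sup>2}"
    by (intro closed_Collect_all closed_Collect_conj closed_Collect_le continuous_intros)
  ultimately show "closed (effects :: (complex ^ 'n ^ 'n) set)"
    unfolding effects_def by (rule closed_Collect_conj)
  show "bounded (effects :: (complex ^ 'n ^ 'n) set)"
    unfolding bounded_iff
  proof (intro exI ballI)
    fix X :: "complex ^ 'n ^ 'n" assume "X \<in> effects"
    then have "hermitian X" and X01: "\<And>x. 0 \<le> qform X x \<and> qform X x \<le> (norm x)\<^sup>2"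
      by (auto simp: effects_def)
    then obtain e :: "'n \<Rightarrow> complex ^ 'n" and l :: "'n \<Rightarrow> real" where e: "orthonormal_basis e"
      and X: "X = (\<Sum>k\<in>UNIV. l k *\<^sub>R outer (e k) (e k))"
      using hermitian_spectral by blast
    have "qform X (e k) = l k" for k
      unfolding X by (rule qform_spectral_sum_basis[OF e])
    then have "\<bar>l k\<bar> \<le> 1" for k
      using X01[of "e k"] by (simp add: orthonormal_basis_norm[OF e])
    then have "norm (l k *\<^sub>R outer (e k) (e k)) \<le> 1" for k
      by (simp add: norm_outer orthonormal_basis_norm[OF e])
    then have "norm X \<le> (\<Sum>k\<in>(UNIV::'n set). 1)"
      unfolding X by (intro sum_norm_le)
    then show "norm X \<le> real CARD('n)" by simp
  qed
qed

text \<open>An effect attains the bounds 0 and 1 of its form only on the corresponding eigenspaces: there the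
  form of \<open>-X\<close>, respectively of \<open>X - 1\<close>, is at its maximum 0.\<close>

lemma effect_kernel:
  assumes X: "X \<in> effects" and "qform X x = 0"
  shows "X *v x = 0"
proof -
  have "(- 1) *\<^sub>R X *v x = 0"
  proof (rule hermitian_form_extremal)
    show "hermitian ((- 1) *\<^sub>R X)"
      using X hermitian_scaleR[of X "- 1"] by (simp add: effects_def)
    show "qform ((- 1) *\<^sub>R X) y \<le> 0" for y
      unfolding qform_scaleR using X by (simp add: effects_def)
    show "qform ((- 1) *\<^sub>R X) x = 0"
      using assms(2) by (simp only: qform_scaleR)
  qed
  then show ?thesis by (simp only: matrix_scaleR_mult_vec) simp
qed

lemma effect_fixed:
  assumes X: "X \<in> effects" and "qform X x = (norm x)\<^sup>2"
  shows "X *v x = x"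
proof -
  have "(X - mat (of_real 1)) *v x = 0"
  proof (rule hermitian_form_extremal)
    show "hermitian (X - mat (of_real 1))"
      using X by (intro hermitian_diff hermitian_mat_of_real) (simp add: effects_def)
    show "qform (X - mat (of_real 1)) y \<le> 0" for y
      using X by (simp only: qform_diff qform_mat) (simp add: effects_def)
    show "qform (X - mat (of_real 1)) x = 0"
      using assms(2) by (simp only: qform_diff qform_mat)
  qed
  then show ?thesis by (simp add: matrix_vector_mult_diff_rdistrib)
qed

text \<open>The witness is the spectral projection of \<open>B = \<Sum>\<^sub>i w\<^sub>i w\<^sub>i\<^sup>*\<close> belonging to the nonzero
  eigenvalues. It is the orthogonal projection onto the span of the \<open>w i\<close>, because the kernel of \<open>B\<close> is the orthogonal
  complement of that span.\<close>

lemma exists_projection: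
  fixes w :: "'i \<Rightarrow> complex ^ 'n"
  assumes "finite I"
  shows "\<exists>P\<in>effects. (\<forall>i\<in>I. P *v w i = w i) \<and> (\<forall>z. (\<forall>i\<in>I. hinner (w i) z = 0) \<longrightarrow> P *v z = 0)"
proof -
  define B where "B = (\<Sum>i\<in>I. outer (w i) (w i))"
  have hB: "hermitian B" unfolding B_def by (intro hermitian_sum hermitian_outer)
  have Bz: "B *v z = (\<Sum>i\<in>I. hinner (w i) z *s w i)" for z
    by (simp add: B_def matrix_sum_mult_vec outer_mult_vec)
  have kerB: "hinner (w i) z = 0" if "B *v z = 0" "i \<in> I" for i z
  proof -
    have "hinner z (B *v z) = of_real (\<Sum>i\<in>I. (cmod (hinner (w i) z))\<^sup>2)"
      by (simp add: Bz hinner_sum_right hinner_scale_right hinner_mult_cnj)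
    then have "(\<Sum>i\<in>I. (cmod (hinner (w i) z))\<^sup>2) = 0"
      using that(1) by (metis hinner_zero_right of_real_eq_0_iff)
    then show ?thesis
      using that(2) assms by (simp add: sum_nonneg_eq_0_iff)
  qed
  obtain e :: "'n \<Rightarrow> complex ^ 'n" and l :: "'n \<Rightarrow> real" where e: "orthonormal_basis e"
    and B: "B = (\<Sum>k\<in>UNIV. l k *\<^sub>R outer (e k) (e k))"
    using hermitian_spectral[OF hB] by blast
  have Be: "B *v e k = l k *\<^sub>R e k" for k
  proof -
    have "B *v e k = (\<Sum>j\<in>UNIV. if j = k then l j *\<^sub>R e j else 0)"
      unfolding B spectral_sum_mult_vec using e
      by (intro sum.cong) (auto simp: orthonormal_basis_def)
    then show ?thesis by simp
  qed
  define g where "g k = (if l k = 0 then 0 else 1::real)" for k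
  define P where "P = (\<Sum>k\<in>UNIV. g k *\<^sub>R outer (e k) (e k))"
  have Pz: "P *v z = (\<Sum>k\<in>UNIV. g k *\<^sub>R (hinner (e k) z *s e k))" for z
    unfolding P_def by (rule spectral_sum_mult_vec)
  have "P \<in> effects"
  proof -
    have "qform P x = (\<Sum>k\<in>UNIV. g k * (cmod (hinner (e k) x))\<^sup>2)" for x
      by (simp add: P_def hinner_spectral_sum)
    moreover have "(\<Sum>k\<in>UNIV. g k * (cmod (hinner (e k) x))\<^sup>2) \<le> (norm x)\<^sup>2" for x
      unfolding orthonormal_basis_Parseval[OF e] by (intro sum_mono) (simp add: g_def)
    moreover have "0 \<le> (\<Sum>k\<in>UNIV. g k * (cmod (hinner (e k) x))\<^sup>2)" for x
      by (intro sum_nonneg) (simp add: g_def)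
    ultimately show ?thesis
      using hermitian_spectral_sum by (auto simp: effects_def P_def)
  qed
  moreover have "P *v w i = w i" if "i \<in> I" for i
  proof -
    have "g k *\<^sub>R (hinner (e k) (w i) *s e k) = hinner (e k) (w i) *s e k" for k
    proof (cases "l k = 0")
      case True
      then have "hinner (w i) (e k) = 0" using kerB that Be by simp
      then have "hinner (e k) (w i) = 0" using cnj_hinner[of "w i" "e k"] by simp
      then show ?thesis by simp
    qed (simp add: g_def)
    then show ?thesis
      using orthonormal_basis_expansion(1)[OF e, of "w i"] by (simp add: Pz)
  qed
  moreover have "P *v z = 0" if "\<forall>i\<in>I. hinner (w i) z = 0" for z
  proof -
    have "B *v z = 0" using that by (simp add: Bz)
    then have "hinner (B *v e k) z = 0" for k
      by (simp flip: hinner_hermitian[OF hB])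
    then have "l k = 0 \<or> hinner (e k) z = 0" for k
      by (simp add: Be hinner_scaleR_left)
    then have "g k *\<^sub>R (hinner (e k) z *s e k) = 0" for k
      by (auto simp: g_def)
    then show ?thesis unfolding Pz by (intro sum.neutral) blast
  qed
  ultimately show ?thesis by blast
qed

section \<open>The maps defined by a Kraus family\<close>

lemma hinner_kraus_Phi:
  "hinner x (kraus_Phi m V X *v y) = (\<Sum>i=1..m. hinner (V i *v x) (X *v (V i *v y)))"
  by (simp add: kraus_Phi_def matrix_sum_mult_vec hinner_sum_right hinner_adjoint
      flip: matrix_vector_mul_assoc)

lemma qform_kraus_Phi: "qform (kraus_Phi m V X) x = (\<Sum>i=1..m. qform X (V i *v x))"
  by (simp add: hinner_kraus_Phi)

lemma hermitian_conjugation: "hermitian X \<Longrightarrow> hermitian (A ** X ** adjoint_mat A)"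
  by (simp add: hermitian_def adjoint_mult matrix_mul_assoc)

lemma hermitian_kraus_Phi: "hermitian X \<Longrightarrow> hermitian (kraus_Phi m V X)"
  unfolding kraus_Phi_def
  by (intro hermitian_sum) (metis adjoint_adjoint hermitian_conjugation)

lemma hermitian_kraus_Psi: "hermitian X \<Longrightarrow> hermitian (kraus_Psi m V X)"
  unfolding kraus_Psi_def by (intro hermitian_sum hermitian_conjugation)

lemma kraus_Psi_diff: "kraus_Psi m V A - kraus_Psi m V B = kraus_Psi m V (A - B)"
  unfolding kraus_Psi_def sum_subtractf[symmetric]
  by (simp add: matrix_matrix_mult_def vec_eq_iff algebra_simps sum_subtractf)

lemma trace_kraus_duality: "trace (X ** kraus_Psi m V A) = trace (kraus_Phi m V X ** A)"
proof -
  have "trace (X ** (V i ** A ** adjoint_mat (V i))) = trace (adjoint_mat (V i) ** X ** V i ** A)" for i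
    using trace_mul_sym[of "X ** V i ** A" "adjoint_mat (V i)"] by (simp add: matrix_mul_assoc)
  then show ?thesis
    by (simp add: kraus_Psi_def kraus_Phi_def matrix_mult_sum_right matrix_mult_sum_left trace_sum)
qed

locale kraus_family =
  fixes m :: nat and V :: "nat \<Rightarrow> complex ^ 'n ^ 'n"
  assumes unital: "(\<Sum>i=1..m. adjoint_mat (V i) ** V i) = mat 1"
begin

(* With 1 rewritten to Suc 0 in the goals, sums over {1..m} would no longer match the lemmas
   about them used as rewrite rules. *)
declare One_nat_def [simp del]

lemma hinner_kraus_sum: "(\<Sum>i=1..m. hinner (V i *v x) (V i *v y)) = hinner x y"
proof -
  have "(\<Sum>i=1..m. hinner (V i *v x) (V i *v y)) = hinner x ((\<Sum>i=1..m. adjoint_mat (V i) ** V i) *v y)"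
    by (simp add: matrix_sum_mult_vec hinner_sum_right hinner_adjoint flip: matrix_vector_mul_assoc)
  then show ?thesis by (simp add: unital)
qed

lemma norm_kraus_sum: "(\<Sum>i=1..m. (norm (V i *v x))\<^sup>2) = (norm x)\<^sup>2"
proof -
  have "complex_of_real (\<Sum>i=1..m. (norm (V i *v x))\<^sup>2) = of_real ((norm x)\<^sup>2)"
    using hinner_kraus_sum[of x x] by (simp add: hinner_self)
  then show ?thesis by (simp only: of_real_eq_iff)
qed

lemma kraus_Phi_contraction:
  assumes "\<And>x. \<bar>qform X x\<bar> \<le> (norm x)\<^sup>2"
  shows "\<bar>qform (kraus_Phi m V X) x\<bar> \<le> (norm x)\<^sup>2"
proof -
  have "\<bar>qform (kraus_Phi m V X) x\<bar> \<le> (\<Sum>i=1..m. \<bar>qform X (V i *v x)\<bar>)"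
    unfolding qform_kraus_Phi by (rule sum_abs)
  also have "\<dots> \<le> (\<Sum>i=1..m. (norm (V i *v x))\<^sup>2)"
    by (intro sum_mono assms)
  finally show ?thesis by (simp add: norm_kraus_sum)
qed

lemma trace_norm_kraus_Psi_le:
  assumes "hermitian A"
  shows "trace_norm (kraus_Psi m V A) \<le> trace_norm A"
proof -
  obtain X where X: "\<And>x. \<bar>qform X x\<bar> \<le> (norm x)\<^sup>2"
    "Re (trace (X ** kraus_Psi m V A)) = trace_norm (kraus_Psi m V A)"
    using trace_norm_attained[OF hermitian_kraus_Psi[OF assms]] by blast
  then have "trace_norm (kraus_Psi m V A) = Re (trace (kraus_Phi m V X ** A))"
    by (simp add: trace_kraus_duality)
  also have "\<dots> \<le> trace_norm A"
    by (intro trace_mult_le_trace_norm[OF assms] kraus_Phi_contraction X)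
  finally show ?thesis .
qed

lemma hilbert_dual_opnorm_le_1: "hilbert_dual_opnorm (kraus_Psi m V) \<le> 1"
proof -
  have "trace_norm (kraus_Psi m V \<rho>1 - kraus_Psi m V \<rho>2) / trace_norm (\<rho>1 - \<rho>2) \<le> 1"
    if "\<rho>1 \<in> density_matrices" "\<rho>2 \<in> density_matrices" for \<rho>1 \<rho>2
  proof -
    have "hermitian (\<rho>1 - \<rho>2)"
      using that by (intro hermitian_diff) (auto simp: density_matrices_def possemidef_def)
    from trace_norm_kraus_Psi_le[OF this] trace_norm_nonneg[OF this] show ?thesis
      by (cases "trace_norm (\<rho>1 - \<rho>2) = 0") (simp_all add: kraus_Psi_diff divide_le_eq_1)
  qed
  then show ?thesis
    unfolding hilbert_dual_opnorm_def by (auto intro!: SUP_least)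
qed

lemma lambda_kraus_Phi:
  assumes "hermitian X"
  shows "lambda_max (kraus_Phi m V X) \<le> lambda_max X" "lambda_min X \<le> lambda_min (kraus_Phi m V X)"
proof -
  obtain x where x: "norm x = 1" "qform (kraus_Phi m V X) x = lambda_max (kraus_Phi m V X)"
    using lambda_max_attained[OF hermitian_kraus_Phi[OF assms]] by blast
  have "(\<Sum>i=1..m. qform X (V i *v x)) \<le> (\<Sum>i=1..m. lambda_max X * (norm (V i *v x))\<^sup>2)"
    by (intro sum_mono qform_le_lambda_max assms)
  then show "lambda_max (kraus_Phi m V X) \<le> lambda_max X"
    using x by (simp add: qform_kraus_Phi norm_kraus_sum flip: sum_distrib_left)
  obtain y where y: "norm y = 1" "qform (kraus_Phi m V X) y = lambda_min (kraus_Phi m V X)"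
    using lambda_min_attained[OF hermitian_kraus_Phi[OF assms]] by blast
  have "(\<Sum>i=1..m. lambda_min X * (norm (V i *v y))\<^sup>2) \<le> (\<Sum>i=1..m. qform X (V i *v y))"
    by (intro sum_mono lambda_min_le_qform assms)
  then show "lambda_min X \<le> lambda_min (kraus_Phi m V X)"
    using y by (simp add: qform_kraus_Phi norm_kraus_sum flip: sum_distrib_left)
qed

lemma hilbert_opnorm_le_1: "hilbert_opnorm (kraus_Phi m V) \<le> 1"
proof -
  have "(lambda_max (kraus_Phi m V X) - lambda_min (kraus_Phi m V X)) / (lambda_max X - lambda_min X) \<le> 1"
    if "hermitian X" "X \<notin> range (\<lambda>t::real. mat (complex_of_real t))" for X
    using lambda_kraus_Phi[OF that(1)] lambda_min_less_lambda_max[OF that] by (simp add: divide_le_eq_1)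
  then show ?thesis
    unfolding hilbert_opnorm_def by (auto intro!: SUP_least)
qed

section \<open>When the norms are equal to 1\<close>

text \<open>The maximum of \<open>f\<close> over the compact set \<open>K\<close> bounds all the ratios in the definition of
  \<open>hilbert_opnorm\<close>, so it is at least 1, while \<open>f\<close> is a number at most 1 minus a number at least 0.
  At the maximiser both extremes are attained, and the equality cases for effects apply to
  each summand.\<close>

lemma orthogonal_ranges_if_hilbert_opnorm_eq_1:
  assumes "hilbert_opnorm (kraus_Phi m V) = 1"
  shows "\<exists>u v. u \<noteq> 0 \<and> v \<noteq> 0 \<and> (\<forall>i\<in>{1..m}. \<forall>j\<in>{1..m}. hinner (V i *v u) (V j *v v) = 0)"
proof -
  define f where "f = (\<lambda>(X, x, y). (\<Sum>i=1..m. qform X (V i *v x)) - (\<Sum>i=1..m. qform X (V i *v y)))"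
  define K where "K = (effects :: (complex ^ 'n ^ 'n) set) \<times> sphere (0 :: complex ^ 'n) 1 \<times> sphere (0 :: complex ^ 'n) 1"
  have "compact K"
    unfolding K_def by (intro compact_Times compact_effects compact_sphere)
  moreover have "0 \<in> (effects :: (complex ^ 'n ^ 'n) set)"
    by (simp add: effects_def hermitian_def)
  then have "(0, axis undefined 1, axis undefined 1) \<in> K"
    by (simp add: K_def)
  then have "K \<noteq> {}" by blast
  moreover have "continuous_on K f"
    unfolding f_def case_prod_unfold by (intro continuous_intros)
  ultimately obtain X x y where Xxy: "(X, x, y) \<in> K" and
    max: "\<And>X' x' y'. (X', x', y') \<in> K \<Longrightarrow> f (X', x', y') \<le> f (X, x, y)"
    using continuous_attains_sup[of K f] by (metis prod_cases3)
  have ratio: "(lambda_max (kraus_Phi m V Z) - lambda_min (kraus_Phi m V Z)) / (lambda_max Z - lambda_min Z)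
      \<le> f (X, x, y)"
    if Z: "hermitian Z" "Z \<notin> range (\<lambda>t::real. mat (complex_of_real t))" for Z
  proof -
    define a where "a = lambda_min Z"
    define d where "d = lambda_max Z - lambda_min Z"
    have d: "d > 0" using lambda_min_less_lambda_max[OF Z] by (simp add: d_def)
    \<comment> \<open>the eigenvalues of \<open>Z\<close> are moved from \<open>[a, a + d]\<close> to \<open>[0, 1]\<close>\<close>
    define Z' where "Z' = (1 / d) *\<^sub>R (Z - mat (of_real a))"
    have q: "qform Z' z = (qform Z z - a * (norm z)\<^sup>2) / d" for z
      by (simp only: Z'_def qform_scaleR qform_diff qform_mat times_divide_eq_left mult_1)
    have "Z' \<in> effects"
    proof -
      have "hermitian Z'"
        unfolding Z'_def by (intro hermitian_scaleR hermitian_diff Z hermitian_mat_of_real)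
      moreover have "0 \<le> qform Z' z \<and> qform Z' z \<le> (norm z)\<^sup>2" for z
        unfolding q using qform_le_lambda_max[OF Z(1), of z] lambda_min_le_qform[OF Z(1), of z] d
        by (simp add: field_simps) (simp add: a_def d_def algebra_simps)
      ultimately show ?thesis by (simp add: effects_def)
    qed
    obtain p where p: "norm p = 1" "qform (kraus_Phi m V Z) p = lambda_max (kraus_Phi m V Z)"
      using lambda_max_attained[OF hermitian_kraus_Phi[OF Z(1)]] by blast
    obtain r where r: "norm r = 1" "qform (kraus_Phi m V Z) r = lambda_min (kraus_Phi m V Z)"
      using lambda_min_attained[OF hermitian_kraus_Phi[OF Z(1)]] by blast
    have sumq: "(\<Sum>i=1..m. qform Z' (V i *v z)) = (qform (kraus_Phi m V Z) z - a) / d"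
      if "norm z = 1" for z
      unfolding q qform_kraus_Phi sum_divide_distrib[symmetric] sum_subtractf sum_distrib_left[symmetric]
      by (simp add: norm_kraus_sum that)
    have "f (Z', p, r) = (lambda_max (kraus_Phi m V Z) - lambda_min (kraus_Phi m V Z)) / d"
      by (simp only: f_def prod.case sumq[OF p(1)] sumq[OF r(1)] p(2) r(2))
         (simp add: diff_divide_distrib)
    moreover have "f (Z', p, r) \<le> f (X, x, y)"
      using \<open>Z' \<in> effects\<close> p r by (intro max) (simp add: K_def)
    ultimately show ?thesis by (simp add: d_def)
  qed
  \<comment> \<open>in dimension 1 the norm is 0 by convention\<close>
  have "CARD('n) \<noteq> 1"
    using assms by (auto simp: hilbert_opnorm_def)
  then have "hilbert_opnorm (kraus_Phi m V) \<le> ereal (f (X, x, y))"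
    unfolding hilbert_opnorm_def using ratio by (auto intro!: SUP_least)
  then have f1: "f (X, x, y) \<ge> 1" using assms by simp
  have X: "X \<in> effects" and x: "norm x = 1" and y: "norm y = 1"
    using Xxy by (auto simp: K_def)
  have le: "qform X (V i *v x) \<le> (norm (V i *v x))\<^sup>2" and ge: "0 \<le> qform X (V i *v y)" for i
    using X by (auto simp: effects_def)
  have "(\<Sum>i=1..m. qform X (V i *v x)) \<le> (\<Sum>i=1..m. (norm (V i *v x))\<^sup>2)"
    by (intro sum_mono le)
  then have sx: "(\<Sum>i=1..m. qform X (V i *v x)) \<le> 1" by (simp add: norm_kraus_sum x)
  have sy: "(\<Sum>i=1..m. qform X (V i *v y)) \<ge> 0" by (intro sum_nonneg ge)
  have eqs: "(\<Sum>i=1..m. qform X (V i *v x)) = 1" "(\<Sum>i=1..m. qform X (V i *v y)) = 0"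
    using f1 sx sy by (simp_all add: f_def)
  have "(\<Sum>i=1..m. (norm (V i *v x))\<^sup>2 - qform X (V i *v x)) = 0"
    unfolding sum_subtractf eqs by (simp add: norm_kraus_sum x)
  then have "\<forall>i\<in>{1..m}. (norm (V i *v x))\<^sup>2 - qform X (V i *v x) = 0"
    by (subst (asm) sum_nonneg_eq_0_iff) (use le in auto)
  then have fixed: "X *v (V i *v x) = V i *v x" if "i \<in> {1..m}" for i
    using that by (intro effect_fixed[OF X]) auto
  have "\<forall>i\<in>{1..m}. qform X (V i *v y) = 0"
    using eqs(2) by (subst (asm) sum_nonneg_eq_0_iff) (use ge in auto)
  then have ker: "X *v (V i *v y) = 0" if "i \<in> {1..m}" for i
    using that by (intro effect_kernel[OF X]) auto
  have "hinner (V i *v x) (V j *v y) = 0" if "i \<in> {1..m}" "j \<in> {1..m}" for i j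
  proof -
    have "hinner (X *v (V i *v x)) (V j *v y) = hinner (V i *v x) (X *v (V j *v y))"
      using X hinner_hermitian[of X] by (simp add: effects_def)
    then show ?thesis by (simp only: fixed[OF that(1)] ker[OF that(2)] hinner_zero_right)
  qed
  moreover have "x \<noteq> 0" "y \<noteq> 0" using x y by auto
  ultimately show ?thesis by blast
qed

text \<open>The projection \<open>P\<close> onto the span of the \<open>V i u\<close> separates the two families of vectors
  completely. It attains the first norm itself, and its reflection \<open>2 P - 1\<close> distinguishes perfectly the
  images under \<open>\<Psi>\<close> of the pure states of \<open>u\<close> and \<open>v\<close>. These states differ, and the dimension is
  not 1, because \<open>\<langle>u, v\<rangle> = \<Sum>\<^sub>i \<langle>V i u, V i v\<rangle> = 0\<close>.\<close>

lemma opnorms_eq_1_if_orthogonal_ranges: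
  assumes u: "norm u = 1" and v: "norm v = 1"
    and orth: "\<And>i j. i \<in> {1..m} \<Longrightarrow> j \<in> {1..m} \<Longrightarrow> hinner (V i *v u) (V j *v v) = 0"
  shows "hilbert_opnorm (kraus_Phi m V) = 1" and "hilbert_dual_opnorm (kraus_Psi m V) = 1"
proof -
  have uv: "hinner u v = 0"
    using hinner_kraus_sum[of u v] orth by simp
  have card: "CARD('n) \<noteq> 1"
  proof
    assume "CARD('n) = 1"
    then obtain i where i: "(UNIV :: 'n set) = {i}" by (rule card_1_singletonE)
    then have "u $ i = 0 \<or> v $ i = 0" using uv unfolding hinner_def i by simp
    moreover have "k = i" for k using i by auto
    ultimately have "u = 0 \<or> v = 0" by (metis vec_eq_iff zero_index)
    then show False using u v by auto
  qed
  obtain P where P: "P \<in> effects" and Pu: "\<And>i. i \<in> {1..m} \<Longrightarrow> P *v (V i *v u) = V i *v u"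
    and Pv: "\<And>j. j \<in> {1..m} \<Longrightarrow> P *v (V j *v v) = 0"
    using exists_projection[of "{1..m}" "\<lambda>i. V i *v u"] orth by auto
  have hP: "hermitian P" using P by (simp add: effects_def)
  note hP' = hermitian_kraus_Phi[OF hP, of m V]
  have qu: "qform (kraus_Phi m V P) u = 1"
    by (simp add: qform_kraus_Phi Pu hinner_self norm_kraus_sum u)
  have qv: "qform (kraus_Phi m V P) v = 0"
    by (simp add: qform_kraus_Phi Pv)
  have nonscalar: "P \<notin> range (\<lambda>t::real. mat (complex_of_real t))"
  proof
    assume "P \<in> range (\<lambda>t::real. mat (complex_of_real t))"
    then obtain t :: real where "P = mat (of_real t)" by auto
    then have "qform (kraus_Phi m V P) z = t * (norm z)\<^sup>2" for z
      by (simp only: qform_kraus_Phi qform_mat norm_kraus_sum flip: sum_distrib_left)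
    then show False using qu qv u v by simp
  qed
  have "lambda_max P \<le> 1" "lambda_min P \<ge> 0"
  proof -
    obtain p r where "norm p = 1" "qform P p = lambda_max P" "norm r = 1" "qform P r = lambda_min P"
      using lambda_max_attained[OF hP] lambda_min_attained[OF hP] by blast
    moreover have "0 \<le> qform P r" "qform P p \<le> (norm p)\<^sup>2"
      using P by (auto simp: effects_def)
    ultimately show "lambda_max P \<le> 1" "lambda_min P \<ge> 0" by simp_all
  qed
  moreover have "1 \<le> lambda_max (kraus_Phi m V P)" "lambda_min (kraus_Phi m V P) \<le> 0"
    using qform_le_lambda_max[OF hP', of u] qu u lambda_min_le_qform[OF hP', of v] qv v by auto
  ultimately have "1 \<le> (lambda_max (kraus_Phi m V P) - lambda_min (kraus_Phi m V P)) / (lambda_max P - lambda_min P)"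
    using lambda_min_less_lambda_max[OF hP nonscalar] by (simp add: le_divide_eq_1)
  then have "1 \<le> hilbert_opnorm (kraus_Phi m V)"
    unfolding hilbert_opnorm_def using card hP nonscalar
    by (auto intro!: SUP_upper2[of P])
  then show "hilbert_opnorm (kraus_Phi m V) = 1"
    using hilbert_opnorm_le_1 by simp

  define A where "A = outer u u - outer v v"
  have dens: "outer z z \<in> density_matrices" if "norm z = 1" for z :: "complex ^ 'n"
  proof -
    have "0 \<le> qform (outer z z) x" for x
      by (simp add: outer_mult_vec hinner_scale_right hinner_mult_cnj)
    then show ?thesis
      using that by (simp add: density_matrices_def possemidef_def hermitian_outer trace_outer hinner_self)
  qed
  have hA: "hermitian A" unfolding A_def by (intro hermitian_diff hermitian_outer)
  have trA: "Re (trace (Z ** A)) = qform Z u - qform Z v" for Z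
  proof -
    have "Z ** A = Z ** outer u u - Z ** outer v v"
      by (simp add: A_def matrix_matrix_mult_def vec_eq_iff algebra_simps sum_subtractf)
    then show ?thesis by (simp add: trace_sub matrix_mult_outer trace_outer)
  qed
  have "outer u u \<noteq> outer v v"
  proof
    assume "outer u u = outer v v"
    then have "outer u u *v v = outer v v *v v" by simp
    then show False using uv u v by (auto simp: outer_mult_vec hinner_self)
  qed
  have ge2: "2 \<le> trace_norm (kraus_Psi m V A)"
  proof -
    define S where "S = 2 *\<^sub>R P - mat (of_real 1)"
    have qS: "qform S z = 2 * qform P z - (norm z)\<^sup>2" for z
      by (simp only: S_def qform_diff qform_scaleR qform_mat)
    have "\<bar>qform S z\<bar> \<le> (norm z)\<^sup>2" for z
    proof -
      have "0 \<le> qform P z" "qform P z \<le> (norm z)\<^sup>2" using P by (auto simp: effects_def)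
      then show ?thesis unfolding qS by linarith
    qed
    then have "Re (trace (S ** kraus_Psi m V A)) \<le> trace_norm (kraus_Psi m V A)"
      by (intro trace_mult_le_trace_norm hermitian_kraus_Psi hA)
    moreover have "qform (kraus_Phi m V S) z = 2 * qform (kraus_Phi m V P) z - (norm z)\<^sup>2" for z
      unfolding qform_kraus_Phi qS sum_subtractf norm_kraus_sum by (simp add: sum_distrib_left)
    ultimately show ?thesis
      by (simp add: trace_kraus_duality trA qu qv u v)
  qed
  have le2: "trace_norm A \<le> 2"
  proof -
    obtain Z where Z: "\<And>x. \<bar>qform Z x\<bar> \<le> (norm x)\<^sup>2" "Re (trace (Z ** A)) = trace_norm A"
      using trace_norm_attained[OF hA] by blast
    then show ?thesis using Z(1)[of u] Z(1)[of v] u v by (simp add: trA)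
  qed
  have "1 \<le> trace_norm (kraus_Psi m V (outer u u) - kraus_Psi m V (outer v v)) / trace_norm (outer u u - outer v v)"
    using ge2 le2 trace_norm_kraus_Psi_le[OF hA] by (simp add: kraus_Psi_diff le_divide_eq_1 flip: A_def)
  then have "1 \<le> hilbert_dual_opnorm (kraus_Psi m V)"
    unfolding hilbert_dual_opnorm_def using card dens u v \<open>outer u u \<noteq> outer v v\<close>
    by (auto intro!: SUP_upper2[of "(outer u u, outer v v)"])
  then show "hilbert_dual_opnorm (kraus_Psi m V) = 1"
    using hilbert_dual_opnorm_le_1 by simp
qed

end

section \<open>Rank-one matrices and the equivalence\<close>

lemma rank_one_iff_outer:
  fixes Y :: "complex ^ 'n ^ 'm"
  shows "rank Y = 1 \<longleftrightarrow> (\<exists>a b. a \<noteq> 0 \<and> b \<noteq> 0 \<and> Y = outer a b)"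
proof
  assume "rank Y = 1"
  then obtain B where B: "card B = 1" "B \<subseteq> rows Y" "vec.independent B" "rows Y \<subseteq> vec.span B"
    using vec.basis_exists[of "rows Y"] unfolding row_rank_def_gen by metis
  from B(1) obtain w where w: "B = {w}" by (rule card_1_singletonE)
  have "row i Y \<in> vec.span {w}" for i
    using B w by (auto simp: rows_def)
  then have "\<exists>c. row i Y = c *s w" for i
    by (auto simp: vec.span_singleton)
  then obtain c where c: "\<And>i. row i Y = c i *s w" by metis
  have "Y = outer (\<chi> i. c i) (\<chi> j. cnj (w $ j))"
    using c by (simp add: vec_eq_iff outer_def row_def)
  moreover have "w \<noteq> 0" using B(3) w by auto
  then have "(\<chi> j. cnj (w $ j)) \<noteq> 0" by (auto simp: vec_eq_iff)
  moreover have "(\<chi> i. c i) \<noteq> 0"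
  proof
    assume "(\<chi> i. c i) = 0"
    then have "row i Y = 0" for i by (simp add: c vec_eq_iff)
    then show False using B(2) w \<open>w \<noteq> 0\<close> by (auto simp: rows_def)
  qed
  ultimately show "\<exists>a b. a \<noteq> 0 \<and> b \<noteq> 0 \<and> Y = outer a b" by blast
next
  assume "\<exists>a b. a \<noteq> 0 \<and> b \<noteq> 0 \<and> Y = outer a b"
  then obtain a b where a: "a \<noteq> 0" and b: "b \<noteq> 0" and Y: "Y = outer a b" by blast
  define w where "w = (\<chi> j. cnj (b $ j))"
  have w: "w \<noteq> 0" using b by (auto simp: w_def vec_eq_iff)
  have row: "row i Y = a $ i *s w" for i
    by (simp add: Y outer_def row_def w_def vec_eq_iff)
  obtain i where i: "a $ i \<noteq> 0" using a by (auto simp: vec_eq_iff)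
  have "vec.dim (rows Y) = card {row i Y}"
  proof (rule vec.dim_unique)
    show "{row i Y} \<subseteq> rows Y" by (auto simp: rows_def)
    have "row j Y = (a $ j / a $ i) *s row i Y" for j
      using i by (simp add: row vec_eq_iff)
    then show "rows Y \<subseteq> vec.span {row i Y}"
      unfolding rows_def vec.span_singleton by blast
    show "vec.independent {row i Y}"
      using i w by (simp add: row)
  qed simp
  then show "rank Y = 1" by (simp add: row_rank_def_gen)
qed

theorem corollary7p3:
  fixes m :: nat and V :: "nat \<Rightarrow> complex ^ 'n ^ 'n"
  assumes "(\<Sum>i=1..m. adjoint_mat (V i) ** V i) = mat 1"
  shows "((hilbert_opnorm (kraus_Phi m V) = 1 \<and> hilbert_dual_opnorm (kraus_Psi m V) = 1)
          \<longleftrightarrow> (\<exists>u v. u \<noteq> 0 \<and> v \<noteq> 0 \<and>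
                (\<forall>i\<in>{1..m}. \<forall>j\<in>{1..m}. hinner (V i *v u) (V j *v v) = 0)))
       \<and> ((\<exists>u v. u \<noteq> 0 \<and> v \<noteq> 0 \<and>
                (\<forall>i\<in>{1..m}. \<forall>j\<in>{1..m}. hinner (V i *v u) (V j *v v) = 0))
          \<longleftrightarrow> (\<exists>Y :: complex ^ 'n ^ 'n. rank Y = 1 \<and>
                (\<forall>i\<in>{1..m}. \<forall>j\<in>{1..m}. trace (adjoint_mat (V i) ** V j ** Y) = 0)))"
  (is "(?norms \<longleftrightarrow> ?vectors) \<and> (_ \<longleftrightarrow> ?rank_one)")
proof
  interpret kraus_family m V by unfold_locales fact
  show "?norms \<longleftrightarrow> ?vectors"
  proof
    assume ?norms
    then show ?vectors by (intro orthogonal_ranges_if_hilbert_opnorm_eq_1) simp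
  next
    assume ?vectors
    then obtain u v where "u \<noteq> 0" "v \<noteq> 0" and
      orth: "\<And>i j. i \<in> {1..m} \<Longrightarrow> j \<in> {1..m} \<Longrightarrow> hinner (V i *v u) (V j *v v) = 0"
      by blast
    have "norm ((1 / norm u) *\<^sub>R u) = 1" "norm ((1 / norm v) *\<^sub>R v) = 1"
      using \<open>u \<noteq> 0\<close> \<open>v \<noteq> 0\<close> by simp_all
    moreover have "hinner (V i *v ((1 / norm u) *\<^sub>R u)) (V j *v ((1 / norm v) *\<^sub>R v)) = 0"
      if "i \<in> {1..m}" "j \<in> {1..m}" for i j
      by (simp only: matrix_mult_vec_scaleR hinner_scaleR_left hinner_scaleR_right orth[OF that])
         simp
    ultimately show ?norms
      using opnorms_eq_1_if_orthogonal_ranges by blast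
  qed
  have tr: "trace (adjoint_mat (V i) ** V j ** outer v u) = hinner (V i *v u) (V j *v v)" for i j u v
    by (simp add: matrix_mult_outer trace_outer hinner_adjoint flip: matrix_vector_mul_assoc)
  show "?vectors \<longleftrightarrow> ?rank_one"
  proof
    assume ?vectors
    then obtain u v where "u \<noteq> 0" "v \<noteq> 0" and
      orth: "\<forall>i\<in>{1..m}. \<forall>j\<in>{1..m}. hinner (V i *v u) (V j *v v) = 0"
      by blast
    then have "rank (outer v u) = 1" unfolding rank_one_iff_outer by blast
    with orth show ?rank_one by (intro exI[of _ "outer v u"]) (simp only: tr simp_thms)
  next
    assume ?rank_one
    then obtain Y :: "complex ^ 'n ^ 'n" where "rank Y = 1" and
      Y: "\<forall>i\<in>{1..m}. \<forall>j\<in>{1..m}. trace (adjoint_mat (V i) ** V j ** Y) = 0"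
      by blast
    then obtain v u where "v \<noteq> 0" "u \<noteq> 0" "Y = outer v u"
      unfolding rank_one_iff_outer by blast
    then show ?vectors using Y by (intro exI[of _ u] exI[of _ v]) (simp only: tr simp_thms)
  qed
qed

end
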